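(* Let $D$ be a division ring. Then for all integers $n \geq 1$ the ring $\mathbb{M}_n(D)$ of $n \times n$ matrices over $D$ is nil-good.
   Context: Rings are associative with unity. An element $a$ of a ring $R$ is nil-good if $a = n + u$, where $n \in R$ is nilpotent and $u \in R$ is either $0$ or a unit of $R$. A ring is nil-good if every one of its elements is nil-good. *)

theory Defs
  imports "Jordan_Normal_Form.Matrix" "HOL-Algebra.Ring"
begin

(* The exponent k = 0 qualifies only in the zero ring, where x is zero anyway. *)
definition nilpotent_elem :: "('a, 'b) ring_scheme \<Rightarrow> 'a \<Rightarrow> bool" where
  "nilpotent_elem R x \<longleftrightarrow> x \<in> carrier R \<and> (\<exists>k::nat. x [^]\<^bsub>R\<^esub> k = \<zero>\<^bsub>R\<^esub>)"

definition nil_good_elem :: "('a, 'b) ring_scheme \<Rightarrow> 'a \<Rightarrow> bool" where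
  "nil_good_elem R a \<longleftrightarrow>
     (\<exists>x u. nilpotent_elem R x \<and> (u = \<zero>\<^bsub>R\<^esub> \<or> u \<in> Units R) \<and> a = x \<oplus>\<^bsub>R\<^esub> u)"

definition nil_good_ring :: "('a, 'b) ring_scheme \<Rightarrow> bool" where
  "nil_good_ring R \<longleftrightarrow> ring R \<and> (\<forall>a \<in> carrier R. nil_good_elem R a)"

end

theory Submission
  imports Defs "HOL-Combinatorics.Permutations"
begin

text \<open>
  The idea is to conjugate a matrix until its entries on and below the diagonal can be completed,
  by a free choice of the entries above the diagonal, to an invertible matrix \<open>U\<close>. Then \<open>A - U\<close> is
  strictly upper triangular, hence nilpotent, and \<open>A = (A - U) + U\<close> is the required decomposition.

  Such a completion exists as soon as the bottom left corner \<open>c\<close> of \<open>A\<close> is nonzero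
  (\<open>nil_good_mat_if_corner\<close>). Row operations with the last row clear the rest of the first column;
  they shift the free entries by constants, so that these remain free.
  What then remains to be made invertible is the block formed by all rows but the last and all
  columns but the first. The positions strictly above the diagonal of \<open>A\<close> are the positions on and
  above the diagonal of this block, so that it can be chosen lower triangular with ones on its
  diagonal.

  A matrix with some nonzero entry off the diagonal acquires a nonzero corner by a simultaneous
  permutation of its rows and columns. A diagonal matrix is zero, or invertible, or has a zero and a
  nonzero diagonal entry; in the last case conjugation by an elementary matrix produces a nonzero
  entry off the diagonal.

  In place of determinants, which noncommutativity rules out, invertibility rests on explicit
  inverses of permutation and diagonal matrices and of \<open>1 - x\<close> for nilpotent \<open>x\<close>.
\<close>

section \<open>Nil-good elements of a ring\<close>

text \<open>
  The inverse is the finite geometric series \<open>1 + x + x\<^sup>2 + \<dots>\<close>, whose partial sums \<open>s\<close> commute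
  with \<open>x\<close>; hence it is a two-sided inverse.
\<close>

lemma (in ring) one_minus_nilpotent_Units:
  assumes "nilpotent_elem R x"
  shows "\<one> \<ominus> x \<in> Units R"
proof -
  have x: "x \<in> carrier R" and "\<exists>k::nat. x [^] k = \<zero>"
    using assms by (auto simp: nilpotent_elem_def)
  then obtain k :: nat where k: "x [^] k = \<zero>" by blast
  have "\<exists>s \<in> carrier R. s \<otimes> x = x \<otimes> s \<and> (\<one> \<ominus> x) \<otimes> s = \<one> \<ominus> x [^] k" for k :: nat
  proof (induction k)
    case 0
    show ?case using x by (intro bexI[of _ \<zero>]) (auto simp: minus_eq r_neg)
  next
    case (Suc k)
    then obtain s where s: "s \<in> carrier R" "s \<otimes> x = x \<otimes> s"
      and geom: "(\<one> \<ominus> x) \<otimes> s = \<one> \<ominus> x [^] k" by blast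
    let ?p = "x [^] k"
    have p: "?p \<in> carrier R" using x by simp
    have "(s \<oplus> ?p) \<otimes> x = x \<otimes> (s \<oplus> ?p)"
      using x s p nat_pow_comm[of x k 1] by (simp add: l_distr r_distr)
    moreover have "(\<one> \<ominus> x) \<otimes> (s \<oplus> ?p) = \<one> \<ominus> x [^] Suc k"
    proof -
      have "(\<one> \<ominus> x) \<otimes> (s \<oplus> ?p) = (\<one> \<ominus> ?p) \<oplus> (\<one> \<ominus> x) \<otimes> ?p"
        using x s p geom by (simp add: r_distr)
      also have "\<dots> = \<one> \<ominus> x \<otimes> ?p"
        using x p by algebra
      also have "x \<otimes> ?p = x [^] Suc k"
        using x nat_pow_Suc2[of x k] by simp
      finally show ?thesis .
    qed
    ultimately show ?case using s p by blast
  qed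
  then obtain s where s: "s \<in> carrier R" "s \<otimes> x = x \<otimes> s" "(\<one> \<ominus> x) \<otimes> s = \<one> \<ominus> x [^] k"
    by blast
  have r: "(\<one> \<ominus> x) \<otimes> s = \<one>" using s k by (simp add: minus_eq)
  have "s \<otimes> (\<one> \<ominus> x) = s \<ominus> s \<otimes> x"
    using s(1) x by (simp add: minus_eq r_distr r_minus)
  also have "\<dots> = s \<ominus> x \<otimes> s" by (simp only: s(2))
  also have "\<dots> = (\<one> \<ominus> x) \<otimes> s" using s(1) x by (simp add: minus_eq l_distr l_minus)
  finally have "s \<otimes> (\<one> \<ominus> x) = \<one>" using r by simp
  then show ?thesis using r s(1) x unfolding Units_def by auto
qed

text \<open>
  Conjugation preserves nilpotent elements and units. The relation \<open>g \<otimes> a = b \<otimes> g\<close> stands for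
  \<open>b = g \<otimes> a \<otimes> inv g\<close> and can be checked without computing the inverse of \<open>g\<close>.
\<close>

lemma (in ring) nil_good_elem_conj:
  assumes g: "g \<in> Units R" and a: "a \<in> carrier R" and b: "nil_good_elem R b"
    and conj: "g \<otimes> a = b \<otimes> g"
  shows "nil_good_elem R a"
proof -
  let ?h = "inv g"
  have gc: "g \<in> carrier R" and h: "?h \<in> Units R" "?h \<in> carrier R"
    and gh: "g \<otimes> ?h = \<one>" and hg: "?h \<otimes> g = \<one>"
    using g by auto
  obtain x u where x: "nilpotent_elem R x" and u: "u = \<zero> \<or> u \<in> Units R"
    and bxu: "b = x \<oplus> u"
    using b unfolding nil_good_elem_def by blast
  have xc: "x \<in> carrier R" using x by (simp add: nilpotent_elem_def)
  have uc: "u \<in> carrier R" using u by auto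
  have pow: "(?h \<otimes> x \<otimes> g) [^] k = ?h \<otimes> x [^] k \<otimes> g" for k :: nat
  proof (induction k)
    case 0
    show ?case using h hg by simp
  next
    case (Suc k)
    have "(?h \<otimes> x \<otimes> g) [^] Suc k = ?h \<otimes> (x [^] k \<otimes> (g \<otimes> ?h) \<otimes> x) \<otimes> g"
      using Suc h gc xc by (simp del: Units_r_inv add: m_assoc)
    then show ?case using gh h gc xc by simp
  qed
  obtain k :: nat where "x [^] k = \<zero>" using x by (auto simp: nilpotent_elem_def)
  then have "(?h \<otimes> x \<otimes> g) [^] k = \<zero>" using pow h gc by simp
  then have nil: "nilpotent_elem R (?h \<otimes> x \<otimes> g)"
    using h gc xc unfolding nilpotent_elem_def by blast
  have unit: "?h \<otimes> u \<otimes> g = \<zero> \<or> ?h \<otimes> u \<otimes> g \<in> Units R"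
    using u g h gc by auto
  have "a = ?h \<otimes> g \<otimes> a" using hg a by simp
  also have "\<dots> = ?h \<otimes> (x \<oplus> u) \<otimes> g" using conj bxu h gc a xc uc by (simp add: m_assoc)
  also have "\<dots> = ?h \<otimes> x \<otimes> g \<oplus> ?h \<otimes> u \<otimes> g" using h gc xc uc by (simp add: l_distr r_distr)
  finally show ?thesis using nil unit unfolding nil_good_elem_def by blast
qed

section \<open>Triangular and permutation matrices\<close>

lemma ring_mat_ring_1: "ring (ring_mat TYPE('a :: ring_1) n b)"
  by (unfold_locales, insert add_inv_exists_mat, auto simp: ring_mat_def algebra_simps Units_def)

lemma ring_mat_minus:
  fixes A B :: "'a :: ring_1 mat"
  assumes A: "A \<in> carrier_mat n n" and B: "B \<in> carrier_mat n n"
  shows "A \<ominus>\<^bsub>ring_mat TYPE('a) n b\<^esub> B = A - B"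
proof -
  interpret ring "ring_mat TYPE('a) n b" by (rule ring_mat_ring_1)
  have B': "- B \<in> carrier_mat n n" using B by simp
  have "\<ominus>\<^bsub>ring_mat TYPE('a) n b\<^esub> B = - B"
    by (rule minus_equality) (use B B' in \<open>auto simp: ring_mat_simps intro!: eq_matI\<close>)
  then show ?thesis using A B by (auto simp: minus_eq ring_mat_simps)
qed

lemma mult_mat_index:
  assumes "A \<in> carrier_mat n m" "B \<in> carrier_mat m k" "i < n" "j < k"
  shows "(A * B) $$ (i, j) = (\<Sum>l<m. A $$ (i, l) * B $$ (l, j))"
  using assms by (auto simp: scalar_prod_def atLeast0LessThan intro!: sum.cong)

text \<open>
  A nonzero entry of the power \<open>A ^ k\<close> at \<open>(i, j)\<close> comes from a path of length \<open>k\<close> from \<open>i\<close> to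
  \<open>j\<close> along nonzero entries of \<open>A\<close>. The height \<open>h\<close> increases at every step but is bounded on the
  finitely many indices, so long paths do not exist.
\<close>

lemma nilpotent_mat_if_graded:
  fixes A :: "'a :: ring_1 mat" and h :: "nat \<Rightarrow> nat"
  assumes A: "A \<in> carrier_mat n n"
    and graded: "\<And>i j. i < n \<Longrightarrow> j < n \<Longrightarrow> A $$ (i, j) \<noteq> 0 \<Longrightarrow> h i < h j"
  shows "nilpotent_elem (ring_mat TYPE('a) n b) A"
proof -
  let ?R = "ring_mat TYPE('a) n b"
  interpret ring ?R by (rule ring_mat_ring_1)
  note [simp] = ring_mat_simps
  have carr: "A [^]\<^bsub>?R\<^esub> k \<in> carrier_mat n n" for k :: nat
    using nat_pow_closed[of A k] A by simp
  have climb: "h i + k \<le> h j" if "i < n" "j < n" "(A [^]\<^bsub>?R\<^esub> k) $$ (i, j) \<noteq> 0" for i j and k :: nat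
    using that
  proof (induction k arbitrary: j)
    case 0
    then show ?case by (auto split: if_splits)
  next
    case (Suc k)
    have "(\<Sum>l<n. (A [^]\<^bsub>?R\<^esub> k) $$ (i, l) * A $$ (l, j)) \<noteq> 0"
      using Suc.prems mult_mat_index[OF carr A, of i j k] by simp
    then obtain l where l: "l < n" "(A [^]\<^bsub>?R\<^esub> k) $$ (i, l) * A $$ (l, j) \<noteq> 0"
      by (metis (no_types, lifting) sum.neutral lessThan_iff)
    then have "(A [^]\<^bsub>?R\<^esub> k) $$ (i, l) \<noteq> 0" "A $$ (l, j) \<noteq> 0" by auto
    then show ?case using Suc.IH[of l] graded[of l j] l Suc.prems by simp
  qed
  define k where "k = Suc (\<Sum>j<n. h j)"
  have "h j < k" if "j < n" for j
    using member_le_sum[of j "{..<n}" h] that by (simp add: k_def)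
  then have "(A [^]\<^bsub>?R\<^esub> k) $$ (i, j) = 0" if "i < n" "j < n" for i j
    using climb[of i j k] that by force
  then have "A [^]\<^bsub>?R\<^esub> k = 0\<^sub>m n n"
    using carr[of k] by (intro eq_matI) auto
  then show ?thesis using A unfolding nilpotent_elem_def by auto
qed

text \<open>
  Dividing each row by its diagonal entry leaves \<open>1 - N\<close> with \<open>N\<close> nilpotent. The height \<open>h\<close> makes
  the lemma cover upper and lower triangular matrices at once; one case would not follow from the
  other by transposition, which does not reverse products over a noncommutative ring.
\<close>

lemma triangular_mat_Units:
  fixes A :: "'a :: division_ring mat" and h :: "nat \<Rightarrow> nat"
  assumes A: "A \<in> carrier_mat n n"
    and graded: "\<And>i j. i < n \<Longrightarrow> j < n \<Longrightarrow> i \<noteq> j \<Longrightarrow> A $$ (i, j) \<noteq> 0 \<Longrightarrow> h i < h j"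
    and diag: "\<And>i. i < n \<Longrightarrow> A $$ (i, i) \<noteq> 0"
  shows "A \<in> Units (ring_mat TYPE('a) n b)"
proof -
  let ?R = "ring_mat TYPE('a) n b"
  interpret ring ?R by (rule ring_mat_ring_1)
  note [simp] = ring_mat_simps
  let ?D = "mat_diag n (\<lambda>i. A $$ (i, i))" and ?E = "mat_diag n (\<lambda>i. inverse (A $$ (i, i)))"
  define N where "N = 1\<^sub>m n - ?E * A"
  have "?D * ?E = 1\<^sub>m n" "?E * ?D = 1\<^sub>m n"
    unfolding mat_diag_diag using diag by (auto simp: mat_diag_def intro!: eq_matI)
  then have D: "?D \<in> Units ?R" unfolding Units_def by (auto intro!: bexI[of _ ?E])
  have EA: "?E * A \<in> carrier_mat n n" using A by (intro mult_carrier_mat[OF mat_diag_dim])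
  have N: "N \<in> carrier_mat n n" using EA unfolding N_def by (intro minus_carrier_mat) auto
  have "nilpotent_elem ?R N"
  proof (rule nilpotent_mat_if_graded[OF N])
    fix i j assume "i < n" "j < n" "N $$ (i, j) \<noteq> 0"
    then show "h i < h j"
      using A diag graded[of i j] unfolding N_def
      by (cases "i = j") (auto simp: mat_diag_mult_left[OF A])
  qed
  then have "1\<^sub>m n - N \<in> Units ?R"
    using one_minus_nilpotent_Units[of N] N by (simp add: ring_mat_minus)
  then have "?D * (1\<^sub>m n - N) \<in> Units ?R" using Units_m_closed[OF D] by simp
  also have "1\<^sub>m n - N = ?E * A"
    using EA by (auto simp: N_def intro!: eq_matI)
  also have "?D * (?E * A) = (?D * ?E) * A"
    using assoc_mult_mat[OF mat_diag_dim mat_diag_dim A] by simp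
  finally show ?thesis using A \<open>?D * ?E = 1\<^sub>m n\<close> by simp
qed

definition perm_mat :: "nat \<Rightarrow> (nat \<Rightarrow> nat) \<Rightarrow> 'a :: {zero, one} mat" where
  "perm_mat n \<sigma> = mat n n (\<lambda>(i, j). if j = \<sigma> i then 1 else 0)"

lemma perm_mat_carrier [simp]: "perm_mat n \<sigma> \<in> carrier_mat n n"
  by (simp add: perm_mat_def)

lemma perm_mat_mult_left:
  fixes A :: "'a :: ring_1 mat"
  assumes A: "A \<in> carrier_mat n n" and \<sigma>: "\<sigma> permutes {..<n}" and "i < n" "j < n"
  shows "(perm_mat n \<sigma> * A) $$ (i, j) = A $$ (\<sigma> i, j)"
proof -
  have "(perm_mat n \<sigma> * A) $$ (i, j) = (\<Sum>l<n. (if l = \<sigma> i then A $$ (l, j) else 0))"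
    unfolding mult_mat_index[OF perm_mat_carrier A \<open>i < n\<close> \<open>j < n\<close>]
    using assms by (intro sum.cong) (auto simp: perm_mat_def)
  also have "\<dots> = A $$ (\<sigma> i, j)"
    using permutes_in_image[OF \<sigma>, of i] \<open>i < n\<close> by simp
  finally show ?thesis .
qed

lemma perm_mat_mult_right:
  fixes A :: "'a :: ring_1 mat"
  assumes A: "A \<in> carrier_mat n n" and \<sigma>: "\<sigma> permutes {..<n}" and "i < n" "j < n"
  shows "(A * perm_mat n \<sigma>) $$ (i, \<sigma> j) = A $$ (i, j)"
proof -
  have j': "\<sigma> j < n" using permutes_in_image[OF \<sigma>, of j] \<open>j < n\<close> by simp
  have "(A * perm_mat n \<sigma>) $$ (i, \<sigma> j) = (\<Sum>l<n. (if l = j then A $$ (i, l) else 0))"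
    unfolding mult_mat_index[OF A perm_mat_carrier \<open>i < n\<close> j']
    using assms j' permutes_inj[OF \<sigma>] by (intro sum.cong) (auto simp: perm_mat_def inj_eq)
  also have "\<dots> = A $$ (i, j)" using \<open>j < n\<close> by simp
  finally show ?thesis .
qed

lemma perm_mat_Units:
  assumes \<sigma>: "\<sigma> permutes {..<n}"
  shows "(perm_mat n \<sigma> :: 'a :: ring_1 mat) \<in> Units (ring_mat TYPE('a) n b)"
proof -
  have *: "perm_mat n \<tau> * perm_mat n (inv_into UNIV \<tau>) = (1\<^sub>m n :: 'a mat)" if \<tau>: "\<tau> permutes {..<n}" for \<tau>
  proof (rule eq_matI)
    fix i j assume "i < dim_row (1\<^sub>m n :: 'a mat)" "j < dim_col (1\<^sub>m n :: 'a mat)"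
    then have ij: "i < n" "j < n" by auto
    then have "\<tau> i < n" using permutes_in_image[OF \<tau>, of i] by simp
    then show "(perm_mat n \<tau> * perm_mat n (inv_into UNIV \<tau>)) $$ (i, j) = (1\<^sub>m n :: 'a mat) $$ (i, j)"
      using ij permutes_inverses(2)[OF \<tau>]
      unfolding perm_mat_mult_left[OF perm_mat_carrier \<tau> ij] by (auto simp: perm_mat_def)
  qed (auto simp: perm_mat_def)
  have "perm_mat n (inv_into UNIV \<sigma>) * perm_mat n \<sigma> = (1\<^sub>m n :: 'a mat)"
    using *[OF permutes_inv[OF \<sigma>]] permutes_inv_inv[OF \<sigma>] by simp
  then show ?thesis using *[OF \<sigma>] unfolding Units_def
    by (auto simp: ring_mat_simps intro!: bexI[of _ "perm_mat n (inv_into UNIV \<sigma>)"])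
qed

section \<open>Matrices over a division ring\<close>

text \<open>
  The completion \<open>U\<close> is the product \<open>F T P\<close> of three invertible matrices. The matrix \<open>F\<close> is the
  identity with its last column replaced by the first column of \<open>A\<close>; it undoes the row operations
  that clear this column. The matrix \<open>P\<close> moves the last column to the front and shifts the others
  to the right by one. The matrix \<open>T\<close> is unit lower triangular: its last column is a unit vector,
  so that \<open>F T\<close> has the first column of \<open>A\<close> as its last one, and its entries below the diagonal
  solve the equations \<open>U(i, k + 1) = A(i, k + 1)\<close> for \<open>k < i\<close>.
\<close>

lemma nil_good_mat_if_corner:
  fixes A :: "'a :: division_ring mat"
  assumes A: "A \<in> carrier_mat (Suc m) (Suc m)" and corner: "A $$ (m, 0) \<noteq> 0"
  shows "nil_good_elem (ring_mat TYPE('a) (Suc m) b) A"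
proof -
  let ?n = "Suc m"
  let ?R = "ring_mat TYPE('a) ?n b"
  interpret ring ?R by (rule ring_mat_ring_1)
  note [simp] = ring_mat_simps
  define c where "c = A $$ (m, 0)"
  define F where "F = mat ?n ?n (\<lambda>(i, j). if j = m then A $$ (i, 0) else if i = j then 1 else 0)"
  define T where "T = mat ?n ?n (\<lambda>(i, k).
    if i = k then 1 else if i < k then 0
    else if i = m then inverse c * A $$ (m, Suc k)
    else A $$ (i, Suc k) - A $$ (i, 0) * (inverse c * A $$ (m, Suc k)))"
  define \<sigma> where "\<sigma> k = (if k = m then 0 else if k < m then Suc k else k)" for k
  define U where "U = F * T * perm_mat ?n \<sigma>"
  have \<sigma>: "\<sigma> permutes {..<?n}"
  proof (rule bij_imp_permutes)
    show "bij_betw \<sigma> {..<?n} {..<?n}"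
      by (rule bij_betw_byWitness[of _ "\<lambda>k. if k = 0 then m else k - 1"]) (auto simp: \<sigma>_def)
  qed (auto simp: \<sigma>_def)
  have F: "F \<in> carrier_mat ?n ?n" and T: "T \<in> carrier_mat ?n ?n"
    by (auto simp: F_def T_def)
  have "F \<in> Units ?R"
    by (rule triangular_mat_Units[OF F, where h = "\<lambda>i. i"])
      (use corner in \<open>auto simp: F_def split: if_splits\<close>)
  moreover have "T \<in> Units ?R"
    by (rule triangular_mat_Units[OF T, where h = "\<lambda>i. m - i"])
      (auto simp: T_def split: if_splits)
  ultimately have U: "U \<in> Units ?R"
    using perm_mat_Units[OF \<sigma>, where ?'a = 'a and b = b] Units_m_closed unfolding U_def by simp
  then have Uc: "U \<in> carrier_mat ?n ?n" using Units_closed by fastforce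
  have FT: "F * T \<in> carrier_mat ?n ?n" using F T by simp
  have FT_index: "(F * T) $$ (i, k) = (if i = m then 0 else T $$ (i, k)) + A $$ (i, 0) * T $$ (m, k)"
    if "i < ?n" "k < ?n" for i k
  proof -
    have "(F * T) $$ (i, k) = (\<Sum>l<m. F $$ (i, l) * T $$ (l, k)) + F $$ (i, m) * T $$ (m, k)"
      using mult_mat_index[OF F T that] by simp
    also have "(\<Sum>l<m. F $$ (i, l) * T $$ (l, k)) = (\<Sum>l<m. if l = i then T $$ (l, k) else 0)"
      using that by (intro sum.cong) (auto simp: F_def)
    also have "\<dots> = (if i = m then 0 else T $$ (i, k))" using that by auto
    finally show ?thesis using that by (simp add: F_def)
  qed
  have agree: "U $$ (i, j) = A $$ (i, j)" if "i < ?n" "j \<le> i" for i j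
  proof (cases j)
    case 0
    have "U $$ (i, \<sigma> m) = (F * T) $$ (i, m)"
      unfolding U_def using that by (intro perm_mat_mult_right[OF FT \<sigma>]) auto
    also have "\<dots> = A $$ (i, 0)" using that by (simp add: FT_index) (auto simp: T_def)
    finally show ?thesis using 0 by (simp add: \<sigma>_def)
  next
    case (Suc k)
    have "U $$ (i, \<sigma> k) = (F * T) $$ (i, k)"
      unfolding U_def using that Suc by (intro perm_mat_mult_right[OF FT \<sigma>]) auto
    also have "\<dots> = A $$ (i, Suc k)"
      using that Suc corner
      by (simp add: FT_index) (auto simp: T_def c_def mult.assoc[symmetric])
    finally show ?thesis using Suc that by (simp add: \<sigma>_def)
  qed
  have N: "A - U \<in> carrier_mat ?n ?n" using Uc by (intro minus_carrier_mat)
  have "nilpotent_elem ?R (A - U)"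
  proof (rule nilpotent_mat_if_graded[OF N, where h = "\<lambda>i. i"])
    fix i j assume "i < ?n" "j < ?n" "(A - U) $$ (i, j) \<noteq> 0"
    then show "i < j" using agree[of i j] Uc by (cases "j \<le> i") auto
  qed
  moreover have "A = (A - U) + U" using A Uc by (intro eq_matI) auto
  ultimately show ?thesis using U unfolding nil_good_elem_def by auto
qed

text \<open>
  Since \<open>p \<noteq> q\<close>, some permutation of the indices moves the position \<open>(p, q)\<close> to the bottom left
  corner.
\<close>

lemma nil_good_mat_if_off_diagonal:
  fixes A :: "'a :: division_ring mat"
  assumes A: "A \<in> carrier_mat n n" and pq: "p < n" "q < n" "p \<noteq> q" "A $$ (p, q) \<noteq> 0"
  shows "nil_good_elem (ring_mat TYPE('a) n b) A"
proof -
  let ?R = "ring_mat TYPE('a) n b"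
  interpret ring ?R by (rule ring_mat_ring_1)
  note [simp] = ring_mat_simps
  obtain m where m: "n = Suc m" using pq by (cases n) auto
  have "m \<noteq> 0" using pq m by auto
  \<comment> \<open>If \<open>p = 0\<close>, moving \<open>q\<close> to \<open>0\<close> displaces \<open>p\<close>; \<open>p'\<close> is where \<open>p\<close> ends up.\<close>
  define p' where "p' = transpose 0 q p"
  have p': "p' \<noteq> 0" "p' < n" using pq by (auto simp: p'_def transpose_def)
  define \<sigma> where "\<sigma> = transpose 0 q \<circ> transpose m p'"
  have \<sigma>: "\<sigma> permutes {..<n}"
    unfolding \<sigma>_def using pq p' m by (intro permutes_compose permutes_swap_id) auto
  have \<sigma>0: "\<sigma> 0 = q" and \<sigma>m: "\<sigma> m = p"
    using p' \<open>m \<noteq> 0\<close> by (simp_all add: \<sigma>_def) (simp add: p'_def)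
  define B where "B = mat n n (\<lambda>(i, j). A $$ (\<sigma> i, \<sigma> j))"
  have B: "B \<in> carrier_mat n n" by (simp add: B_def)
  have good: "nil_good_elem ?R B"
    using nil_good_mat_if_corner[of B m b] B pq \<sigma>0 \<sigma>m by (simp add: m B_def)
  have "perm_mat n \<sigma> * A = B * perm_mat n \<sigma>"
  proof (rule eq_matI)
    fix i j assume "i < dim_row (B * perm_mat n \<sigma>)" "j < dim_col (B * perm_mat n \<sigma>)"
    then have i: "i < n" and j: "j < n" by (auto simp: B_def perm_mat_def)
    define k where "k = inv_into UNIV \<sigma> j"
    have k: "k < n" "\<sigma> k = j"
      using permutes_in_image[OF permutes_inv[OF \<sigma>], of j] j permutes_inverses(1)[OF \<sigma>]
      by (auto simp: k_def)
    show "(perm_mat n \<sigma> * A) $$ (i, j) = (B * perm_mat n \<sigma>) $$ (i, j)"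
      using perm_mat_mult_left[OF A \<sigma> i j] perm_mat_mult_right[OF B \<sigma> i k(1)] i k
      by (simp add: B_def)
  qed (use A in \<open>auto simp: B_def perm_mat_def\<close>)
  then show ?thesis
    using nil_good_elem_conj[OF perm_mat_Units[OF \<sigma>] _ good] A by simp
qed

text \<open>
  Write \<open>E\<close> for the matrix with a single \<open>1\<close>, at position \<open>(p, q)\<close>. Conjugation of \<open>A\<close> by \<open>1 + E\<close>
  gives \<open>A + E A\<close>, because \<open>A E = 0\<close> and \<open>E A E = 0\<close>; its entry at \<open>(p, q)\<close> is the nonzero
  diagonal entry at \<open>q\<close>.
\<close>

lemma nil_good_mat_diagonal_mixed:
  fixes A :: "'a :: division_ring mat"
  assumes A: "A \<in> carrier_mat n n"
    and diag: "\<And>i j. i < n \<Longrightarrow> j < n \<Longrightarrow> i \<noteq> j \<Longrightarrow> A $$ (i, j) = 0"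
    and p: "p < n" "A $$ (p, p) = 0" and q: "q < n" "A $$ (q, q) \<noteq> 0"
  shows "nil_good_elem (ring_mat TYPE('a) n b) A"
proof -
  let ?R = "ring_mat TYPE('a) n b"
  interpret ring ?R by (rule ring_mat_ring_1)
  note [simp] = ring_mat_simps
  have "p \<noteq> q" using p q by auto
  define E :: "'a mat" where "E = mat n n (\<lambda>(i, j). if i = p \<and> j = q then 1 else 0)"
  define B where "B = A + E * A"
  have E: "E \<in> carrier_mat n n" by (simp add: E_def)
  have EA: "E * A \<in> carrier_mat n n" using E A by simp
  have B: "B \<in> carrier_mat n n" using A EA by (simp add: B_def)
  have g: "1\<^sub>m n + E \<in> Units ?R"
    by (rule triangular_mat_Units[where h = "\<lambda>i. if i = p then 0 else 1"])
      (use E \<open>p \<noteq> q\<close> in \<open>auto simp: E_def split: if_splits\<close>)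
  have EA_index: "(E * A) $$ (i, j) = (if i = p then A $$ (q, j) else 0)" if "i < n" "j < n" for i j
  proof -
    have "(E * A) $$ (i, j) = (\<Sum>l<n. if l = q then (if i = p then A $$ (q, j) else 0) else 0)"
      unfolding mult_mat_index[OF E A that] using that by (intro sum.cong) (auto simp: E_def)
    then show ?thesis using q by simp
  qed
  have XE_index: "(X * E) $$ (i, j) = (if j = q then X $$ (i, p) else 0)"
    if "X \<in> carrier_mat n n" "i < n" "j < n" for i j X
  proof -
    have "(X * E) $$ (i, j) = (\<Sum>l<n. if l = p then (if j = q then X $$ (i, p) else 0) else 0)"
      unfolding mult_mat_index[OF that(1) E that(2,3)] using that
      by (intro sum.cong) (auto simp: E_def)
    then show ?thesis using p by simp
  qed
  have "B * E = 0\<^sub>m n n"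
  proof (rule eq_matI)
    fix i j assume "i < dim_row (0\<^sub>m n n :: 'a mat)" "j < dim_col (0\<^sub>m n n :: 'a mat)"
    then have ij: "i < n" "j < n" by auto
    have "B $$ (i, p) = A $$ (i, p) + (E * A) $$ (i, p)"
      unfolding B_def using EA ij p by (intro index_add_mat) auto
    also have "\<dots> = 0"
      using EA_index[OF ij(1) p(1)] diag[OF ij(1) p(1)] diag[OF q(1) p(1)] p \<open>p \<noteq> q\<close> by auto
    finally show "(B * E) $$ (i, j) = 0\<^sub>m n n $$ (i, j)"
      using XE_index[OF B ij] ij by simp
  qed (use B E in auto)
  then have "B * (1\<^sub>m n + E) = B"
    using mult_add_distrib_mat[OF B one_carrier_mat E] B by simp
  moreover have "(1\<^sub>m n + E) * A = B"
    using add_mult_distrib_mat[OF one_carrier_mat E A] A by (simp add: B_def)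
  moreover have "B $$ (p, q) = A $$ (q, q)"
  proof -
    have "B $$ (p, q) = A $$ (p, q) + (E * A) $$ (p, q)"
      unfolding B_def using EA p q by (intro index_add_mat) auto
    then show ?thesis using EA_index[OF p(1) q(1)] diag[OF p(1) q(1) \<open>p \<noteq> q\<close>] by simp
  qed
  then have "nil_good_elem ?R B"
    using nil_good_mat_if_off_diagonal[OF B p(1) q(1) \<open>p \<noteq> q\<close>] q by simp
  ultimately show ?thesis using nil_good_elem_conj[OF g, of A B] A by simp
qed

theorem theorem3p1:
  fixes n :: nat
  assumes "n \<ge> 1"
  shows "nil_good_ring (ring_mat TYPE('a :: division_ring) n ())"
proof -
  let ?R = "ring_mat TYPE('a) n ()"
  interpret ring ?R by (rule ring_mat_ring_1)
  note [simp] = ring_mat_simps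
  have "nil_good_elem ?R A" if A: "A \<in> carrier_mat n n" for A :: "'a mat"
  proof (cases "\<exists>p<n. \<exists>q<n. p \<noteq> q \<and> A $$ (p, q) \<noteq> 0")
    case True
    then obtain p q where "p < n" "q < n" "p \<noteq> q" "A $$ (p, q) \<noteq> 0" by blast
    then show ?thesis by (rule nil_good_mat_if_off_diagonal[OF A])
  next
    case False
    then have diag: "A $$ (i, j) = 0" if "i < n" "j < n" "i \<noteq> j" for i j
      using that by blast
    consider (mixed) p q where "p < n" "A $$ (p, p) = 0" "q < n" "A $$ (q, q) \<noteq> 0"
      | (zero) "\<forall>i<n. A $$ (i, i) = 0"
      | (unit) "\<forall>i<n. A $$ (i, i) \<noteq> 0"
      by blast
    then show ?thesis
    proof cases
      case mixed
      then show ?thesis using nil_good_mat_diagonal_mixed[OF A, of p q "()"] diag by simp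
    next
      case zero
      have "nilpotent_elem ?R A"
      proof (rule nilpotent_mat_if_graded[OF A, where h = "\<lambda>i. i"])
        fix i j assume "i < n" "j < n" "A $$ (i, j) \<noteq> 0"
        then show "i < j" using zero diag[of i j] by (cases "i = j") auto
      qed
      moreover have "A = A + 0\<^sub>m n n" using A by simp
      ultimately show ?thesis unfolding nil_good_elem_def by auto
    next
      case unit
      have "A \<in> Units ?R"
        by (rule triangular_mat_Units[OF A, where h = "\<lambda>i. i"]) (use unit diag in auto)
      moreover have "nilpotent_elem ?R (0\<^sub>m n n)"
        by (rule nilpotent_mat_if_graded[where h = "\<lambda>i. i"]) auto
      moreover have "A = 0\<^sub>m n n + A" using A by simp
      ultimately show ?thesis unfolding nil_good_elem_def by auto
    qed
  qed
  then show ?thesis unfolding nil_good_ring_def using ring_axioms by simp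
qed

end
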